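(* Let $n\ge 3$ and let $V\in RH^{n/2}$ on $\mathbb{R}^n$ satisfy Assumptions $(A_1)$, $(A_2)$, $(A_3)$ (recalled in the context). Then there exists a family $\mathcal{D}^V=\bigcup_{k\in\mathbb{Z}_+}\mathcal{D}_k^V$ of cubes in $\mathbb{R}^n$ with the following properties: (i) for each $k\in\mathbb{Z}_+$, the family $\mathcal{D}_k^V$ is a partition of $\mathbb{R}^n$; moreover, the interiors of the cubes in $\mathcal{D}_k^V$ are pairwise disjoint; (ii) for any $k>l$, $Q\in\mathcal{D}_l^V$ and $P\in\mathcal{D}_k^V$, either $Q\cap P=\emptyset$ or $Q\cap P=P$; (iii) for any $k\in\mathbb{Z}_+$, any $Q\in\mathcal{D}_k^V$ and every $x\in Q$, one has $l(Q)\sim 2^{-k}\rho(x,V)$, with implicit constants independent of $k$, $Q$ and $x$.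
   Context: $\mathbb{Z}_+=\{0,1,2,\dots\}$. $B(x,r)$ is the ball of center $x$ and radius $r$. $l(Q)$ is the side length of a cube $Q$; cubes have edges parallel to the coordinate axes. $f\lesssim g$ means $f\le Cg$ with $C>0$ independent of the main parameters; $f\sim g$ means $f\lesssim g\lesssim f$. For $1<q<\infty$, $RH^q$ is the class of nonnegative $V\in L^q_{\rm loc}(\mathbb{R}^n)$ for which there is $C>1$ with $\left(\frac1{|B|}\int_B V^q\,dx\right)^{1/q}\le \frac{C}{|B|}\int_B V\,dx$ for every ball $B\subseteq\mathbb{R}^n$. The critical radius function is $\rho(x,V):=\sup\left\{r>0:\ \frac1{r^{n-2}}\int_{B(x,r)}V(y)\,dy\le 1\right\}$. Assumptions (with a common $r_0>0$): $(A_1)$ there exists $r_0>0$ such that for all $x\in\mathbb{R}^n$ with $|x|\ge r_0$, $\frac1{|x|^{n-2}}\int_{B(x,|x|)}V(y)\,dy\gtrsim 1$ (i.e. $\ge c$ with $c>0$ independent of $x$); $(A_2)$ there exists $C_D>0$ such that for all $r_1\ge r_0/2$ and $x,y$ with $r_1\le|x|\le|y|<2r_1$, $V(y)\le C_D V(x)$; $(A_3)$ there exists $C_{RD}>0$ such that for all $r_1\ge r_0/2$ and $x,y$ with $r_1\le|x|\le|y|<2r_1$, $V(x)\le C_{RD}V(y)$. *)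

theory Defs
  imports "HOL-Analysis.Analysis"
begin

definition locally_Lq :: "real \<Rightarrow> (real ^ 'n \<Rightarrow> real) set" where
  "locally_Lq q = {f \<in> borel_measurable lebesgue.
     \<forall>K. compact K \<longrightarrow> set_integrable lebesgue K (\<lambda>x. \<bar>f x\<bar> powr q)}"

definition ball_average :: "real ^ 'n \<Rightarrow> real \<Rightarrow> (real ^ 'n \<Rightarrow> real) \<Rightarrow> real" where
  "ball_average z r f = (1 / measure lebesgue (ball z r)) * (LINT x:ball z r|lebesgue. f x)"

definition reverse_Hoelder :: "real \<Rightarrow> (real ^ 'n \<Rightarrow> real) set" where
  "reverse_Hoelder q = {V \<in> locally_Lq q.
     (\<forall>x. 0 \<le> V x) \<and>
     (\<exists>C>1. \<forall>z r. 0 < r \<longrightarrow>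
        ball_average z r (\<lambda>x. V x powr q) powr (1 / q) \<le> C * ball_average z r V)}"

(* The supremum is taken in [0, \<infinity>].  It is only meant for locally integrable V:
   the Bochner integral of a non-integrable function is 0. *)
definition critical_radius :: "real ^ 'n \<Rightarrow> (real ^ 'n \<Rightarrow> real) \<Rightarrow> ennreal" where
  "critical_radius x V =
     (SUP r \<in> {r. 0 < r \<and> (1 / r ^ (CARD('n) - 2)) * (LINT y:ball x r|lebesgue. V y) \<le> 1}.
        ennreal r)"

definition assumption_A1 :: "real \<Rightarrow> (real ^ 'n \<Rightarrow> real) \<Rightarrow> bool" where
  "assumption_A1 r0 V \<longleftrightarrow> (\<exists>c>0. \<forall>x. r0 \<le> norm x \<longrightarrow>
     c \<le> (1 / norm x ^ (CARD('n) - 2)) * (LINT y:ball x (norm x)|lebesgue. V y))"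

definition assumption_A2 :: "real \<Rightarrow> (real ^ 'n \<Rightarrow> real) \<Rightarrow> bool" where
  "assumption_A2 r0 V \<longleftrightarrow> (\<exists>C>0. \<forall>r1 x y.
     r0 / 2 \<le> r1 \<and> r1 \<le> norm x \<and> norm x \<le> norm y \<and> norm y < 2 * r1 \<longrightarrow> V y \<le> C * V x)"

definition assumption_A3 :: "real \<Rightarrow> (real ^ 'n \<Rightarrow> real) \<Rightarrow> bool" where
  "assumption_A3 r0 V \<longleftrightarrow> (\<exists>C>0. \<forall>r1 x y.
     r0 / 2 \<le> r1 \<and> r1 \<le> norm x \<and> norm x \<le> norm y \<and> norm y < 2 * r1 \<longrightarrow> V x \<le> C * V y)"

(* Cubes are half-open, so that families of cubes can be partitions in the set-theoretic sense. *)
definition cube :: "real ^ 'n \<Rightarrow> real \<Rightarrow> (real ^ 'n) set" where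
  "cube a s = {x. \<forall>i. a $ i \<le> x $ i \<and> x $ i < a $ i + s}"

definition is_cube :: "(real ^ 'n) set \<Rightarrow> bool" where
  "is_cube Q \<longleftrightarrow> (\<exists>a s. 0 < s \<and> Q = cube a s)"

definition side_length :: "(real ^ 'n) set \<Rightarrow> real" where
  "side_length Q = (THE s. 0 < s \<and> (\<exists>a. Q = cube a s))"

lemma cube_eq_imp:
  fixes a b :: "real ^ 'n"
  assumes "cube a s = cube b t" and "0 < s" and "0 < t"
  shows "a = b \<and> s = t"
proof -
  have sub: "b $ i \<le> a $ i \<and> a $ i + s \<le> b $ i + t"
    if eq: "cube a s = cube b t" and pos: "0 < s" for a b :: "real ^ 'n" and s t i
  proof -
    have mem: "b $ i \<le> a $ i + u \<and> a $ i + u < b $ i + t" if "0 \<le> u" "u < s" for u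
    proof -
      have "(\<chi> j. a $ j + u) \<in> cube a s"
        using that by (simp add: cube_def)
      then have "(\<chi> j. a $ j + u) \<in> cube b t"
        using eq by simp
      then show ?thesis
        by (simp add: cube_def)
    qed
    have "a $ i + s \<le> b $ i + t"
    proof (rule ccontr)
      assume "\<not> ?thesis"
      moreover have "a $ i < b $ i + t"
        using mem[of 0] pos by simp
      ultimately show False
        using mem[of "b $ i + t - a $ i"] by simp
    qed
    then show ?thesis
      using mem[of 0] pos by simp
  qed
  have "a $ i = b $ i \<and> s = t" for i
    using sub[OF assms(1,2), of i] sub[OF assms(1)[symmetric] assms(3), of i] by linarith
  then show ?thesis
    by (simp add: vec_eq_iff)
qed

lemma side_length_cube: "0 < s \<Longrightarrow> side_length (cube a s) = s"
  unfolding side_length_def by (rule the_equality) (auto dest: cube_eq_imp)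

end

theory Submission
  imports Defs
begin

text \<open>
  Write \<open>n\<close> for the dimension, \<open>q = n / 2\<close>, \<open>M x r = r\<^sup>2\<^sup>-\<^sup>n \<integral>\<^bsub>B(x,r)\<^esub> V\<close>
  and \<open>\<rho>\<close> for the critical radius. The cubes of generation 0 are the maximal dyadic cubes whose side
  is at most \<open>\<rho>\<close> at each of their points, and generation \<open>k\<close> arises from them by \<open>k\<close> dyadic
  subdivisions. Maximality gives a point \<open>y\<close> of the dyadic parent, of side \<open>2 l\<close>, with
  \<open>\<rho> y < 2 l\<close>. Everything therefore rests on \<open>0 < \<rho> < \<infinity>\<close> and on one comparison
  (\<open>critical_radius_comparison\<close>): if \<open>\<bar>x - y\<bar> \<le> d\<close> and \<open>\<rho> y < d\<close>, then \<open>\<rho> x \<le> C d\<close>.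

  In the situation of the comparison, \<open>M y d > 1\<close>, hence \<open>M x (2 d) \<ge> 2\<^sup>2\<^sup>-\<^sup>n\<close>. What is needed is that
  once \<open>M x r \<ge> c\<close>, one has \<open>M x R > 1\<close> for all \<open>R \<ge> \<Lambda> r\<close>, where \<open>\<Lambda>\<close> depends on \<open>V\<close> and
  \<open>c\<close> but not on \<open>x\<close> and \<open>r\<close> (\<open>scaled_mass_growth\<close>). The usual way to such growth is the self-improvement of the reverse
  Hoelder exponent beyond \<open>n / 2\<close>, by Gehring's lemma. The following direct argument works at the
  endpoint. The exponent \<open>n / 2\<close> makes the integral \<open>I x r\<close> of \<open>V\<^sup>q\<close> over \<open>B(x,r)\<close> scale like \<open>M\<^sup>q\<close>:
  Hoelder bounds \<open>M\<close> in terms of \<open>I\<close>, and the reverse Hoelder inequality bounds \<open>I\<close> by \<open>K M\<^sup>q\<close>. As \<open>I\<close>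
  increases with the radius, \<open>M\<close> is almost increasing. Suppose now that \<open>M x R \<le> 1\<close>. Then \<open>I x R \<le> K\<close>,
  and \<open>M\<close> stays between two positive constants on \<open>[r, R]\<close>. So for a large fixed ratio \<open>\<mu>\<close>
  each annulus \<open>B(x, \<mu> s) - B(x, s)\<close> carries a definite share of the mass, and by Hoelder it contributes
  at least a fixed \<open>\<delta> > 0\<close> to \<open>I x R \<le> K\<close>. Hence there are at most \<open>K / \<delta>\<close> such annuli, which
  bounds \<open>R / r\<close>.

  Positivity of \<open>\<rho>\<close> holds because \<open>I x r\<close>, and with it \<open>M x r\<close>, tends to 0 with \<open>r\<close>. Finiteness
  follows from the growth lemma as soon as some ball has positive mass, and \<open>assumption_A1\<close>
  provides one.
\<close>

section \<open>A weak form of Hoelder's inequality\<close>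

text \<open>
  Integrating this pointwise inequality bounds \<open>\<integral> f\<close> by \<open>\<integral> f\<^sup>q\<close> with a free parameter \<open>s\<close>. Optimising
  in \<open>s\<close> would give Hoelder's inequality up to a factor 2; with \<open>s\<close> kept free there is no exceptional
  case \<open>\<integral> f\<^sup>q = 0\<close>.
\<close>

lemma le_add_powr_mult:
  fixes s t q :: real
  assumes "0 < s" "0 \<le> t" "1 \<le> q"
  shows "t \<le> s + s powr (1 - q) * t powr q"
proof (cases "t \<le> s")
  case True
  then show ?thesis by (simp add: add_increasing2)
next
  case False
  then have "t = t powr (1 - q) * t powr q"
    using assms by (simp flip: powr_add)
  also have "\<dots> \<le> s powr (1 - q) * t powr q"
    using False assms by (intro mult_right_mono powr_mono2') auto
  finally show ?thesis using assms by linarith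
qed

lemma set_integrable_of_powr:
  fixes f :: "'a \<Rightarrow> real"
  assumes "E \<in> sets M" "emeasure M E < \<infinity>" "f \<in> borel_measurable M"
    and "\<And>x. 0 \<le> f x" "1 \<le> q" "set_integrable M E (\<lambda>x. f x powr q)"
  shows "set_integrable M E f"
proof -
  have "set_integrable M E (\<lambda>x. 1 + f x powr q)"
    using assms by (intro set_integral_add) (auto simp: set_integrable_def)
  then show ?thesis
  proof (rule set_integrable_bound)
    show "set_borel_measurable M E f"
      using assms by (simp add: set_borel_measurable_def)
    show "AE x in M. x \<in> E \<longrightarrow> norm (f x) \<le> norm (1 + f x powr q)"
      using le_add_powr_mult[of 1 _ q] assms by (auto intro!: AE_I2)
  qed
qed

lemma set_integral_le_powr:
  fixes f :: "'a \<Rightarrow> real"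
  assumes "E \<in> sets M" "emeasure M E < \<infinity>" "f \<in> borel_measurable M"
    and "\<And>x. 0 \<le> f x" "1 \<le> q" "set_integrable M E (\<lambda>x. f x powr q)" "0 < s"
  shows "(LINT x:E|M. f x) \<le> s * measure M E + s powr (1 - q) * (LINT x:E|M. f x powr q)"
proof -
  have c: "set_integrable M E (\<lambda>x. s)"
    using assms by (simp add: set_integrable_def)
  have "(LINT x:E|M. f x) \<le> (LINT x:E|M. s + s powr (1 - q) * f x powr q)"
    using assms c le_add_powr_mult
    by (intro set_integral_mono set_integrable_of_powr[OF assms(1-6)] set_integral_add) auto
  also have "\<dots> = s * measure M E + s powr (1 - q) * (LINT x:E|M. f x powr q)"
    using assms c by (subst set_integral_add) (auto simp: set_lebesgue_integral_def)
  finally show ?thesis .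
qed

section \<open>Growth of the normalised mass on balls\<close>

locale reverse_Hoelder_potential =
  fixes V :: "real ^ 'n \<Rightarrow> real"
  assumes dim: "CARD('n) \<ge> 3"
    and RH: "V \<in> reverse_Hoelder (real CARD('n) / 2)"
begin

definition q :: real where "q = real CARD('n) / 2"

definition unit_vol :: real where "unit_vol = measure lebesgue (ball (0 :: real ^ 'n) 1)"

definition mass :: "(real ^ 'n) set \<Rightarrow> real" where
  "mass E = (LINT y:E|lebesgue. V y)"

text \<open>
  For \<open>q = n / 2\<close> this integral is invariant under the rescaling \<open>V \<mapsto> \<lambda>\<^sup>2 V(\<lambda> \<cdot>)\<close>, as is \<open>scaled_mass\<close>
  below, so that the two can be compared with constants independent of the radius.
\<close>

definition energy :: "(real ^ 'n) set \<Rightarrow> real" where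
  "energy E = (LINT y:E|lebesgue. V y powr q)"

definition scaled_mass :: "real ^ 'n \<Rightarrow> real \<Rightarrow> real" where
  "scaled_mass x r = mass (ball x r) / r ^ (CARD('n) - 2)"

lemma q_gt_1: "1 < q"
  using dim by (simp add: q_def)

lemma power_dim: "r ^ CARD('n) = r ^ (CARD('n) - 2) * r ^ 2" for r :: real
proof -
  have "CARD('n) = (CARD('n) - 2) + 2" using dim by simp
  then show ?thesis by (metis power_add)
qed

lemma unit_vol_pos: "0 < unit_vol"
  unfolding unit_vol_def by (simp add: measure_completion content_ball_pos)

lemma measure_ball: "0 \<le> r \<Longrightarrow> measure lebesgue (ball x r) = unit_vol * r ^ CARD('n)"
  for x :: "real ^ 'n"
  unfolding unit_vol_def using content_ball_conv_unit_ball[of r x]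
  by (simp add: measure_completion)

lemma V_nonneg: "0 \<le> V x"
  using RH by (simp add: reverse_Hoelder_def)

lemma V_measurable: "V \<in> borel_measurable lebesgue"
  using RH by (simp add: reverse_Hoelder_def locally_Lq_def)

lemma powr_integrable_ball: "set_integrable lebesgue (ball x r) (\<lambda>y. V y powr q)"
proof -
  have "set_integrable lebesgue (cball x r) (\<lambda>y. V y powr q)"
    using RH V_nonneg by (auto simp: reverse_Hoelder_def locally_Lq_def q_def)
  then show ?thesis
    by (rule set_integrable_subset) auto
qed

lemma emeasure_subset_ball:
  fixes E :: "(real ^ 'n) set"
  assumes "E \<in> sets lebesgue" "E \<subseteq> ball x r"
  shows "emeasure lebesgue E < \<infinity>"
proof -
  have "emeasure lebesgue E \<le> emeasure lebesgue (ball x r)"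
    using assms by (intro emeasure_mono) auto
  also have "\<dots> < \<infinity>"
    using emeasure_lborel_ball_finite[of x r] by simp
  finally show ?thesis .
qed

lemma integrable_ball: "set_integrable lebesgue (ball x r) V"
  using emeasure_subset_ball[of "ball x r" x r] V_measurable V_nonneg q_gt_1
  by (intro set_integrable_of_powr[OF _ _ _ _ _ powr_integrable_ball]) auto

lemma integrable_subset_ball:
  assumes "E \<in> sets lebesgue" "E \<subseteq> ball x r"
  shows "set_integrable lebesgue E V" "set_integrable lebesgue E (\<lambda>y. V y powr q)"
  using assms by (auto intro: set_integrable_subset[OF integrable_ball]
      set_integrable_subset[OF powr_integrable_ball])

lemma mass_nonneg: "0 \<le> mass E" and energy_nonneg: "0 \<le> energy E"
  unfolding mass_def energy_def set_lebesgue_integral_def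
  using V_nonneg by (auto intro!: integral_nonneg_AE)

lemma scaled_mass_nonneg: "0 \<le> r \<Longrightarrow> 0 \<le> scaled_mass x r"
  using mass_nonneg by (simp add: scaled_mass_def)

lemma mass_eq_scaled_mass: "0 < r \<Longrightarrow> mass (ball x r) = scaled_mass x r * r ^ (CARD('n) - 2)"
  by (simp add: scaled_mass_def)

lemma ball_split:
  fixes x :: "real ^ 'n"
  assumes "r \<le> R"
  shows "mass (ball x R) = mass (ball x r) + mass (ball x R - ball x r)"
    and "energy (ball x R) = energy (ball x r) + energy (ball x R - ball x r)"
proof -
  have *: "ball x R = ball x r \<union> (ball x R - ball x r)"
    using assms by auto
  show "mass (ball x R) = mass (ball x r) + mass (ball x R - ball x r)"
    unfolding mass_def
    by (subst *, rule set_integral_Un) (auto intro!: integrable_subset_ball)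
  show "energy (ball x R) = energy (ball x r) + energy (ball x R - ball x r)"
    unfolding energy_def
    by (subst *, rule set_integral_Un) (auto intro!: integrable_subset_ball)
qed

lemma mass_mono_ball:
  fixes x y :: "real ^ 'n"
  assumes "ball x r \<subseteq> ball y R"
  shows "mass (ball x r) \<le> mass (ball y R)"
proof -
  have *: "ball y R = ball x r \<union> (ball y R - ball x r)"
    using assms by auto
  have "mass (ball y R) = mass (ball x r) + mass (ball y R - ball x r)"
    unfolding mass_def
    by (subst *, rule set_integral_Un) (auto intro!: integrable_subset_ball)
  then show ?thesis
    using mass_nonneg[of "ball y R - ball x r"] by linarith
qed

lemma energy_mono_ball: "r \<le> R \<Longrightarrow> energy (ball x r) \<le> energy (ball x R)"
  using ball_split(2)[of r R x] energy_nonneg[of "ball x R - ball x r"] by linarith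

text \<open>
  The choice \<open>s = \<eta> / r\<^sup>2\<close> in the weak Hoelder inequality makes both terms scale like
  \<open>r\<^sup>n\<^sup>-\<^sup>2\<close>. The set \<open>E\<close> is a ball in some applications and an annulus in others.
\<close>

lemma mass_le_energy:
  assumes "E \<in> sets lebesgue" "E \<subseteq> ball x r" "0 < r" "0 < \<eta>"
  shows "mass E \<le> (\<eta> * unit_vol + \<eta> powr (1 - q) * energy E) * r ^ (CARD('n) - 2)"
proof -
  define s where "s = \<eta> / r ^ 2"
  have "0 < s" using assms by (simp add: s_def)
  have "s * measure lebesgue E \<le> s * measure lebesgue (ball x r)"
    using \<open>0 < s\<close> assms
    by (intro mult_left_mono measure_mono_fmeasurable) (use emeasure_lborel_ball_finite[of x r] in \<open>auto simp: fmeasurable_def\<close>)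
  also have "\<dots> = \<eta> * unit_vol * r ^ (CARD('n) - 2)"
    using assms by (simp add: measure_ball s_def power_dim del: measure_completion)
  finally have 1: "s * measure lebesgue E \<le> \<eta> * unit_vol * r ^ (CARD('n) - 2)" .
  have "s powr (1 - q) = \<eta> powr (1 - q) / (r ^ 2) powr (1 - q)"
    using assms by (simp add: s_def powr_divide)
  also have "\<dots> = \<eta> powr (1 - q) * (r ^ 2) powr (q - 1)"
    using powr_minus_divide[of "r ^ 2" "1 - q"] by simp
  also have "(r ^ 2) powr (q - 1) = r powr (2 * (q - 1))"
    using assms powr_powr[of r 2 "q - 1"] by (simp add: powr_realpow)
  also have "2 * (q - 1) = real (CARD('n) - 2)"
    using dim by (simp add: q_def of_nat_diff)
  also have "r powr real (CARD('n) - 2) = r ^ (CARD('n) - 2)"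
    using assms by (simp add: powr_realpow)
  finally have 2: "s powr (1 - q) = \<eta> powr (1 - q) * r ^ (CARD('n) - 2)" .
  have "mass E \<le> s * measure lebesgue E + s powr (1 - q) * energy E"
    unfolding mass_def energy_def
    using assms V_measurable V_nonneg q_gt_1 \<open>0 < s\<close> emeasure_subset_ball[OF assms(1,2)]
      integrable_subset_ball[OF assms(1,2)]
    by (intro set_integral_le_powr) auto
  with 1 2 show ?thesis by (simp add: algebra_simps)
qed

lemma scaled_mass_le_energy:
  assumes "0 < r" "0 < \<eta>"
  shows "scaled_mass x r \<le> \<eta> * unit_vol + \<eta> powr (1 - q) * energy (ball x r)"
  using mass_le_energy[of "ball x r" x r \<eta>] assms
  by (simp add: scaled_mass_def divide_le_eq)

text \<open>
  This is the reverse Hoelder inequality raised to the power \<open>q\<close>; the powers of \<open>r\<close> cancel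
  because \<open>2 q = n\<close>.
\<close>

lemma energy_le_scaled_mass:
  obtains K where "0 < K" "\<And>x r. 0 < r \<Longrightarrow> energy (ball x r) \<le> K * scaled_mass x r powr q"
proof -
  obtain C where "1 < C" and C: "\<And>z r. 0 < r \<Longrightarrow>
      ball_average z r (\<lambda>x. V x powr q) powr (1 / q) \<le> C * ball_average z r V"
    using RH by (auto simp: reverse_Hoelder_def q_def)
  define K where "K = C powr q * unit_vol powr (1 - q)"
  show thesis
  proof (rule that[of K])
    show "0 < K" using \<open>1 < C\<close> unit_vol_pos by (simp add: K_def)
    fix x :: "real ^ 'n" and r :: real
    assume "0 < r"
    define m where "m = scaled_mass x r"
    have "0 \<le> m" using \<open>0 < r\<close> scaled_mass_nonneg by (simp add: m_def)
    define v where "v = unit_vol * r ^ CARD('n)"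
    have "0 < v" using unit_vol_pos \<open>0 < r\<close> by (simp add: v_def)
    have vol: "measure lebesgue (ball x r) = v"
      using \<open>0 < r\<close> by (simp add: v_def measure_ball del: measure_completion)
    have avg: "ball_average x r (\<lambda>x. V x powr q) = energy (ball x r) / v"
      by (simp add: ball_average_def energy_def vol del: measure_completion)
    have "ball_average x r V = mass (ball x r) / v"
      by (simp add: ball_average_def mass_def vol del: measure_completion)
    also have "\<dots> = m / (unit_vol * r ^ 2)"
      using \<open>0 < r\<close> unit_vol_pos by (simp add: m_def mass_eq_scaled_mass v_def power_dim)
    finally have avgV: "ball_average x r V = m / (unit_vol * r ^ 2)" .
    have "energy (ball x r) / v = ((energy (ball x r) / v) powr (1 / q)) powr q"
      using energy_nonneg[of "ball x r"] \<open>0 < v\<close> q_gt_1 by (simp add: powr_powr)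
    also have "\<dots> \<le> (C * (m / (unit_vol * r ^ 2))) powr q"
      using C[OF \<open>0 < r\<close>, of x] q_gt_1 avg avgV by (intro powr_mono2) auto
    also have "\<dots> = C powr q * m powr q / (unit_vol powr q * (r ^ 2) powr q)"
      using \<open>1 < C\<close> \<open>0 \<le> m\<close> \<open>0 < r\<close> unit_vol_pos by (simp add: powr_mult powr_divide)
    also have "(r ^ 2) powr q = r ^ CARD('n)"
      using \<open>0 < r\<close> powr_powr[of r 2 q] by (simp add: q_def powr_realpow)
    finally have "energy (ball x r) \<le> C powr q * m powr q / (unit_vol powr q * r ^ CARD('n)) * v"
      using \<open>0 < v\<close> by (simp add: pos_divide_le_eq)
    also have "\<dots> = K * m powr q"
      using \<open>0 < r\<close> unit_vol_pos by (simp add: v_def K_def powr_diff)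
    finally show "energy (ball x r) \<le> K * scaled_mass x r powr q"
      by (simp add: m_def)
  qed
qed

text \<open>
  The heart of the matter. As long as the scaled mass stays bounded above and below, consecutive
  annuli of a fixed large ratio each add at least \<open>\<delta>\<close> to an energy that is bounded by \<open>K\<close>, so
  this can happen for only a bounded number of annuli.
\<close>

lemma scaled_mass_growth:
  assumes "0 < c"
  obtains \<Lambda> where "1 \<le> \<Lambda>"
    "\<And>x r R. 0 < r \<Longrightarrow> c \<le> scaled_mass x r \<Longrightarrow> \<Lambda> * r \<le> R \<Longrightarrow> 1 < scaled_mass x R"
proof -
  obtain K where "0 < K" and K: "\<And>x r. 0 < r \<Longrightarrow> energy (ball x r) \<le> K * scaled_mass x r powr q"
    using energy_le_scaled_mass by blast
  \<comment> \<open>Almost monotonicity in the radius, through the monotone energy. A small \<open>\<eta>\<close> turns it into a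
    lower bound at larger radii, and \<open>\<eta> = 1\<close> into an upper bound at smaller ones.\<close>
  have le: "scaled_mass x r \<le> \<eta> * unit_vol + \<eta> powr (1 - q) * (K * scaled_mass x R powr q)"
    if "0 < r" "r \<le> R" "0 < \<eta>" for x r R \<eta>
  proof -
    have "energy (ball x r) \<le> K * scaled_mass x R powr q"
      using energy_mono_ball[OF that(2), of x] K[of R x] that by linarith
    then have "\<eta> powr (1 - q) * energy (ball x r) \<le> \<eta> powr (1 - q) * (K * scaled_mass x R powr q)"
      by (intro mult_left_mono) auto
    then show ?thesis using scaled_mass_le_energy[OF that(1,3), of x] by linarith
  qed
  \<comment> \<open>Chosen so that the term \<open>\<eta>0 * unit_vol\<close> is \<open>c / 2\<close> and can be absorbed on the left.\<close>
  define \<eta>0 where "\<eta>0 = c / (2 * unit_vol)"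
  define a where "a = c / 2 / (\<eta>0 powr (1 - q) * K)"
  define c1 where "c1 = a powr (1 / q)"
  have "0 < \<eta>0" using assms unit_vol_pos by (simp add: \<eta>0_def)
  then have "0 < a" using assms \<open>0 < K\<close> by (simp add: a_def)
  then have "0 < c1" by (simp add: c1_def)
  have lower: "c1 \<le> scaled_mass x s" if "0 < r" "c \<le> scaled_mass x r" "r \<le> s" for x r s
  proof -
    have "c \<le> c / 2 + \<eta>0 powr (1 - q) * (K * scaled_mass x s powr q)"
      using le[OF that(1,3) \<open>0 < \<eta>0\<close>, of x] that(2) unit_vol_pos by (simp add: \<eta>0_def)
    then have "a \<le> scaled_mass x s powr q"
      using \<open>0 < \<eta>0\<close> \<open>0 < K\<close> by (simp add: a_def pos_divide_le_eq algebra_simps)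
    then have "c1 \<le> (scaled_mass x s powr q) powr (1 / q)"
      unfolding c1_def using \<open>0 < a\<close> q_gt_1 by (intro powr_mono2) auto
    then show ?thesis
      using scaled_mass_nonneg[of s x] that q_gt_1 by (simp add: powr_powr)
  qed
  define K1 where "K1 = unit_vol + K"
  have "0 < K1" using unit_vol_pos \<open>0 < K\<close> by (simp add: K1_def)
  \<comment> \<open>So large that the inner ball \<open>B(x, s)\<close> has at most half the mass of \<open>B(x, \<mu> s)\<close>.\<close>
  define \<mu> where "\<mu> = 1 + 2 * K1 / c1"
  have "1 < \<mu>" using \<open>0 < K1\<close> \<open>0 < c1\<close> by (simp add: \<mu>_def)
  \<comment> \<open>Again half of the lower bound \<open>c1 / 2\<close> for the annulus is absorbed; \<open>\<delta>\<close> is what then remains.\<close>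
  define \<eta> where "\<eta> = c1 / (4 * unit_vol)"
  have "0 < \<eta>" using \<open>0 < c1\<close> unit_vol_pos by (simp add: \<eta>_def)
  define \<delta> where "\<delta> = c1 / 4 / \<eta> powr (1 - q)"
  have "0 < \<delta>" using \<open>0 < c1\<close> \<open>0 < \<eta>\<close> by (simp add: \<delta>_def)
  have step: "energy (ball x s) + \<delta> \<le> energy (ball x (\<mu> * s))"
    if "0 < s" "c1 \<le> scaled_mass x (\<mu> * s)" "scaled_mass x s \<le> K1" for x s
  proof -
    let ?A = "ball x (\<mu> * s) - ball x s"
    let ?p = "CARD('n) - 2"
    have "s \<le> \<mu> * s" "0 < \<mu> * s" using \<open>1 < \<mu>\<close> that(1) by auto
    have "\<mu> \<le> \<mu> ^ ?p"
      using \<open>1 < \<mu>\<close> dim by (intro self_le_power) auto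
    moreover have "K1 \<le> c1 / 2 * \<mu>"
      using \<open>0 < c1\<close> by (simp add: \<mu>_def algebra_simps)
    ultimately have "K1 \<le> c1 / 2 * \<mu> ^ ?p"
      using \<open>0 < c1\<close> by (meson half_gt_zero mult_left_mono less_imp_le order_trans)
    then have "K1 * s ^ ?p \<le> c1 / 2 * \<mu> ^ ?p * s ^ ?p"
      using that(1) by (intro mult_right_mono) auto
    then have "K1 * s ^ ?p \<le> c1 / 2 * (\<mu> * s) ^ ?p"
      by (simp add: power_mult_distrib)
    moreover have "mass (ball x s) \<le> K1 * s ^ ?p"
      using that by (simp add: mass_eq_scaled_mass)
    moreover have "c1 * (\<mu> * s) ^ ?p \<le> mass (ball x (\<mu> * s))"
      unfolding mass_eq_scaled_mass[OF \<open>0 < \<mu> * s\<close>]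
      using that \<open>0 < \<mu> * s\<close> by (intro mult_right_mono) auto
    ultimately have "c1 / 2 * (\<mu> * s) ^ ?p \<le> mass ?A"
      using ball_split(1)[OF \<open>s \<le> \<mu> * s\<close>, of x] by linarith
    also have "\<dots> \<le> (\<eta> * unit_vol + \<eta> powr (1 - q) * energy ?A) * (\<mu> * s) ^ ?p"
      using \<open>0 < \<mu> * s\<close> \<open>0 < \<eta>\<close> by (intro mass_le_energy[where x = x]) auto
    finally have "c1 / 2 \<le> \<eta> * unit_vol + \<eta> powr (1 - q) * energy ?A"
      by (rule mult_right_le_imp_le) (use \<open>0 < \<mu> * s\<close> in simp)
    moreover have "\<eta> * unit_vol = c1 / 4"
      using unit_vol_pos by (simp add: \<eta>_def)
    ultimately have "c1 / 4 \<le> \<eta> powr (1 - q) * energy ?A" by linarith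
    then have "\<delta> \<le> energy ?A"
      using \<open>0 < \<eta>\<close> by (simp add: \<delta>_def divide_le_eq mult.commute)
    then show ?thesis
      using ball_split(2)[OF \<open>s \<le> \<mu> * s\<close>, of x] by linarith
  qed
  obtain N :: nat where N: "K < real N * \<delta>"
    using reals_Archimedean3[OF \<open>0 < \<delta>\<close>] by blast
  show thesis
  proof (rule that[of "\<mu> ^ N"])
    show "1 \<le> \<mu> ^ N" using \<open>1 < \<mu>\<close> by (simp add: one_le_power)
    fix x :: "real ^ 'n" and r R :: real
    assume "0 < r" and c: "c \<le> scaled_mass x r" and R: "\<mu> ^ N * r \<le> R"
    show "1 < scaled_mass x R"
    proof (rule ccontr)
      assume "\<not> 1 < scaled_mass x R"
      then have "scaled_mass x R \<le> 1" by simp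
      have "r \<le> \<mu> ^ N * r"
        using \<open>1 < \<mu>\<close> \<open>0 < r\<close> by (simp add: one_le_power)
      then have "r \<le> R" "0 < R" using R \<open>0 < r\<close> by linarith+
      then have "scaled_mass x R powr q \<le> 1 powr q"
        using scaled_mass_nonneg[of R x] \<open>scaled_mass x R \<le> 1\<close> q_gt_1 by (intro powr_mono2) auto
      then have KR: "K * scaled_mass x R powr q \<le> K"
        using \<open>0 < K\<close> by simp
      have upper: "scaled_mass x s \<le> K1" if "0 < s" "s \<le> R" for s
        using le[OF that, of 1 x] KR by (simp add: K1_def)
      have "real m * \<delta> \<le> energy (ball x (\<mu> ^ m * r))" if "m \<le> N" for m
        using that
      proof (induction m)
        case 0
        then show ?case by (simp add: energy_nonneg)
      next
        case (Suc m)
        have pow: "1 \<le> \<mu> ^ m" "\<mu> ^ m \<le> \<mu> ^ N" "1 \<le> \<mu> ^ Suc m"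
          using Suc.prems \<open>1 < \<mu>\<close> by (auto intro!: one_le_power power_increasing simp del: power_Suc)
        have mR: "\<mu> ^ m * r \<le> \<mu> ^ N * r"
          using pow \<open>0 < r\<close> by (intro mult_right_mono) auto
        have s: "r \<le> \<mu> ^ m * r" "r \<le> \<mu> ^ Suc m * r" "\<mu> ^ m * r \<le> R"
          using pow \<open>0 < r\<close> order_trans[OF mR R] by (auto simp del: power_Suc)
        have "energy (ball x (\<mu> ^ m * r)) + \<delta> \<le> energy (ball x (\<mu> * (\<mu> ^ m * r)))"
          using s \<open>0 < r\<close> R lower[OF \<open>0 < r\<close> c s(2)]
          by (intro step upper) (auto simp: mult.assoc)
        with Suc show ?case by (simp add: algebra_simps)
      qed
      from this[of N] have "real N * \<delta> \<le> energy (ball x (\<mu> ^ N * r))" by simp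
      also have "\<dots> \<le> energy (ball x R)" using R by (rule energy_mono_ball)
      also have "\<dots> \<le> K" using K[OF \<open>0 < R\<close>, of x] KR by linarith
      finally show False using N by simp
    qed
  qed
qed

section \<open>The critical radius\<close>

lemma critical_radius_eq:
  "critical_radius x V = (SUP r \<in> {r. 0 < r \<and> scaled_mass x r \<le> 1}. ennreal r)"
  by (simp add: critical_radius_def scaled_mass_def mass_def)

text \<open>
  By absolute continuity the energy of \<open>B(x, r)\<close> tends to 0 with \<open>r\<close>, since points are null sets.
  For \<open>\<eta> = 1 / (2 * unit_vol)\<close> the other term of the Hoelder bound for the scaled mass is \<open>1 / 2\<close>, so
  small radii are admissible in the supremum.
\<close>

lemma critical_radius_pos: "0 < critical_radius x V"
proof -
  define \<eta> where "\<eta> = 1 / (2 * unit_vol)"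
  have "0 < \<eta>" using unit_vol_pos by (simp add: \<eta>_def)
  have Int: "(\<Inter>i. ball x (1 / real (Suc i))) = {x}"
  proof (intro equalityI subsetI)
    fix y assume "y \<in> (\<Inter>i. ball x (1 / real (Suc i)))"
    then have *: "dist x y < 1 / real (Suc i)" for i by auto
    have "dist x y \<le> 0"
    proof (rule ccontr)
      assume "\<not> dist x y \<le> 0"
      then obtain i where "1 / real (Suc i) < dist x y"
        using nat_approx_posE by (metis not_le)
      with *[of i] show False by simp
    qed
    then show "y \<in> {x}" by simp
  qed auto
  have "(\<lambda>i. energy (ball x (1 / real (Suc i)))) \<longlonglongrightarrow> energy {x}"
    unfolding energy_def Int[symmetric]
    by (rule set_integral_cont_down)
      (auto simp: decseq_def intro!: powr_integrable_ball subset_ball divide_left_mono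
        simp del: of_nat_Suc)
  moreover have "energy {x} = 0"
  proof -
    have "{x} \<in> null_sets lebesgue"
      using negligible_sing negligible_iff_null_sets by blast
    then have "AE y in lebesgue. indicator {x} y *\<^sub>R (V y powr q) = 0"
      by (rule eventually_mono[OF AE_not_in]) (simp add: indicator_def)
    then show ?thesis
      unfolding energy_def set_lebesgue_integral_def by (rule integral_eq_zero_AE)
  qed
  ultimately have "(\<lambda>i. \<eta> powr (1 - q) * energy (ball x (1 / real (Suc i)))) \<longlonglongrightarrow> \<eta> powr (1 - q) * 0"
    by (intro tendsto_intros) auto
  then have "\<forall>\<^sub>F i in sequentially. \<eta> powr (1 - q) * energy (ball x (1 / real (Suc i))) < 1 / 2"
    by (rule order_tendstoD) simp
  then obtain i where i: "\<eta> powr (1 - q) * energy (ball x (1 / real (Suc i))) < 1 / 2"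
    by (meson eventually_happens' trivial_limit_sequentially)
  define r where "r = 1 / real (Suc i)"
  have "0 < r" by (simp add: r_def)
  moreover have "\<eta> * unit_vol = 1 / 2" using unit_vol_pos by (simp add: \<eta>_def)
  ultimately have "scaled_mass x r \<le> 1"
    using scaled_mass_le_energy[OF \<open>0 < r\<close> \<open>0 < \<eta>\<close>, of x] i by (simp add: r_def)
  then have "ennreal r \<le> critical_radius x V"
    unfolding critical_radius_eq using \<open>0 < r\<close> by (intro SUP_upper) auto
  moreover have "0 < ennreal r" using \<open>0 < r\<close> by simp
  ultimately show ?thesis by (metis order_less_le_trans)
qed

lemma critical_radius_le:
  assumes "\<And>R. T \<le> R \<Longrightarrow> 1 < scaled_mass x R"
  shows "critical_radius x V \<le> ennreal T"
  unfolding critical_radius_eq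
proof (rule SUP_least)
  fix r assume "r \<in> {r. 0 < r \<and> scaled_mass x r \<le> 1}"
  then show "ennreal r \<le> ennreal T"
    using assms[of r] by (intro ennreal_leI) force
qed

lemma scaled_mass_gt_1:
  assumes "0 < r" "critical_radius x V < ennreal r"
  shows "1 < scaled_mass x r"
proof (rule ccontr)
  assume "\<not> 1 < scaled_mass x r"
  then have "ennreal r \<le> critical_radius x V"
    unfolding critical_radius_eq using \<open>0 < r\<close> by (intro SUP_upper) auto
  with assms show False by simp
qed

text \<open>
  A large ball around \<open>x\<close> contains \<open>B(z, s)\<close>, so its scaled mass is some \<open>c > 0\<close>; the growth lemma
  for this \<open>c\<close> excludes all large radii from the supremum.
\<close>

lemma critical_radius_finite:
  assumes "0 < mass (ball z s)"
  shows "critical_radius x V < \<infinity>"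
proof -
  define r where "r = dist z x + s"
  have "0 < s"
    using assms by (cases "0 < s") (auto simp: mass_def ball_empty set_lebesgue_integral_def)
  then have "0 < r" by (simp add: r_def add_nonneg_pos)
  have "ball z s \<subseteq> ball x r"
  proof
    show "w \<in> ball x r" if "w \<in> ball z s" for w
      using that dist_triangle[of x w z] by (simp add: r_def dist_commute)
  qed
  then have "0 < mass (ball x r)"
    using mass_mono_ball assms by (metis order_less_le_trans)
  then have "0 < scaled_mass x r"
    using \<open>0 < r\<close> by (simp add: scaled_mass_def)
  then obtain \<Lambda> where "\<And>R. \<Lambda> * r \<le> R \<Longrightarrow> 1 < scaled_mass x R"
    using scaled_mass_growth \<open>0 < r\<close> by (metis order_refl)
  then show ?thesis
    using critical_radius_le[of "\<Lambda> * r" x] by (auto simp: order_le_less_trans)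
qed

text \<open>
  Since \<open>B(y, d) \<subseteq> B(x, 2 d)\<close>, the scaled mass at \<open>x\<close> and radius \<open>2 d\<close> is at least
  \<open>2\<^sup>2\<^sup>-\<^sup>n\<close>, and the growth lemma applies with this absolute constant.
\<close>

lemma critical_radius_comparison:
  obtains C where "0 < C" "\<And>x y d. 0 < d \<Longrightarrow> dist x y \<le> d \<Longrightarrow> critical_radius y V < ennreal d
    \<Longrightarrow> critical_radius x V \<le> ennreal (C * d)"
proof -
  have pos: "0 < 1 / (2::real) ^ (CARD('n) - 2)" by simp
  obtain \<Lambda> where "1 \<le> \<Lambda>" and \<Lambda>: "\<And>x r R. 0 < r \<Longrightarrow> 1 / 2 ^ (CARD('n) - 2) \<le> scaled_mass x r
      \<Longrightarrow> \<Lambda> * r \<le> R \<Longrightarrow> 1 < scaled_mass x R"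
    using scaled_mass_growth[OF pos] by metis
  show thesis
  proof (rule that[of "2 * \<Lambda>"])
    show "0 < 2 * \<Lambda>" using \<open>1 \<le> \<Lambda>\<close> by simp
    fix x y :: "real ^ 'n" and d :: real
    assume d: "0 < d" "dist x y \<le> d" "critical_radius y V < ennreal d"
    have "d ^ (CARD('n) - 2) \<le> mass (ball y d)"
      using scaled_mass_gt_1[OF d(1,3)] d(1) by (simp add: mass_eq_scaled_mass)
    also have "\<dots> \<le> mass (ball x (2 * d))"
    proof (intro mass_mono_ball subsetI)
      show "z \<in> ball x (2 * d)" if "z \<in> ball y d" for z
        using that d(2) dist_triangle[of x z y] by simp
    qed
    finally have "1 / 2 ^ (CARD('n) - 2) \<le> scaled_mass x (2 * d)"
      using d(1) by (simp add: scaled_mass_def field_simps power_mult_distrib)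
    then have "1 < scaled_mass x R" if "\<Lambda> * (2 * d) \<le> R" for R
      using \<Lambda>[of "2 * d" x R] d(1) that by simp
    then show "critical_radius x V \<le> ennreal (2 * \<Lambda> * d)"
      by (intro critical_radius_le) (simp add: algebra_simps)
  qed
qed

end

section \<open>Dyadic cubes adapted to a size function\<close>

definition dyadic_cube :: "int \<Rightarrow> real ^ 'n \<Rightarrow> (real ^ 'n) set" where
  "dyadic_cube j x = cube (\<chi> i. 2 powi j * of_int \<lfloor>x $ i / 2 powi j\<rfloor>) (2 powi j)"

text \<open>
  Membership is thus an equivalence relation in \<open>x\<close> and \<open>y\<close>, which makes the cubes of one level a
  partition.
\<close>

lemma mem_dyadic_cube_iff:
  "y \<in> dyadic_cube j x \<longleftrightarrow> (\<forall>i. \<lfloor>y $ i / 2 powi j\<rfloor> = \<lfloor>x $ i / 2 powi j\<rfloor>)"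
proof -
  have "2 powi j * of_int a \<le> t \<and> t < 2 powi j * of_int a + 2 powi j \<longleftrightarrow> \<lfloor>t / 2 powi j\<rfloor> = a"
    for t :: real and a :: int
    by (simp add: floor_eq_iff pos_le_divide_eq pos_divide_less_eq algebra_simps)
  then show ?thesis
    by (simp add: dyadic_cube_def cube_def)
qed

lemma dyadic_cube_self: "x \<in> dyadic_cube j x"
  by (simp add: mem_dyadic_cube_iff)

lemma dyadic_cube_eq: "y \<in> dyadic_cube j x \<Longrightarrow> dyadic_cube j y = dyadic_cube j x"
  by (auto simp: mem_dyadic_cube_iff)

lemma side_length_dyadic_cube: "side_length (dyadic_cube j x) = 2 powi j"
  by (simp add: dyadic_cube_def side_length_cube)

lemma is_cube_dyadic_cube: "is_cube (dyadic_cube j x)"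
proof -
  have "0 < (2 :: real) powi j" by simp
  then show ?thesis unfolding is_cube_def dyadic_cube_def by blast
qed

lemma dyadic_cube_mono:
  assumes "j \<le> k"
  shows "dyadic_cube j x \<subseteq> dyadic_cube k x"
proof
  obtain m where k: "k = j + int m"
    using assms zle_iff_zadd by blast
  have "\<lfloor>t / 2 powi k\<rfloor> = \<lfloor>t / 2 powi j\<rfloor> div 2 ^ m" for t :: real
    using floor_divide_real_eq_div[of "2 ^ m" "t / 2 powi j"]
    by (simp add: k power_int_add)
  then show "y \<in> dyadic_cube k x" if "y \<in> dyadic_cube j x" for y
    using that by (simp add: mem_dyadic_cube_iff)
qed

lemma dist_dyadic_cube:
  fixes x y :: "real ^ 'n"
  assumes "y \<in> dyadic_cube j x"
  shows "dist x y \<le> real CARD('n) * 2 powi j"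
proof -
  have "\<bar>x $ i - y $ i\<bar> \<le> 2 powi j" for i
  proof -
    have "x \<in> cube a s \<Longrightarrow> y \<in> cube a s \<Longrightarrow> \<bar>x $ i - y $ i\<bar> \<le> s" for a s
      unfolding cube_def abs_le_iff mem_Collect_eq by (smt (verit))
    then show ?thesis
      using assms dyadic_cube_self[of x j] unfolding dyadic_cube_def by blast
  qed
  then have "(\<Sum>i\<in>UNIV. \<bar>(x - y) $ i\<bar>) \<le> (\<Sum>i\<in>(UNIV :: 'n set). 2 powi j)"
    by (intro sum_mono) simp
  then show ?thesis
    using norm_le_l1_cart[of "x - y"] by (simp add: dist_norm)
qed

text \<open>
  A stopping-time argument: \<open>J x\<close> is the level of the largest dyadic cube around \<open>x\<close> whose side
  is at most \<open>\<rho>\<close> on the whole cube. Points of that cube select the same cube, whence the first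
  property. The dyadic parent fails the condition at one of its points, and the comparison hypothesis
  carries the resulting bound over to \<open>x\<close>; it also shows that all sufficiently small cubes around
  \<open>x\<close> satisfy the condition, so that the largest one exists.
\<close>

lemma exists_adapted_dyadic_cubes:
  fixes \<rho> :: "real ^ 'n \<Rightarrow> ennreal"
  assumes pos: "\<And>x. 0 < \<rho> x" and fin: "\<And>x. \<rho> x < \<infinity>"
    and "0 < C"
    and comp: "\<And>x y d. 0 < d \<Longrightarrow> dist x y \<le> d \<Longrightarrow> \<rho> y < ennreal d \<Longrightarrow> \<rho> x \<le> ennreal (C * d)"
  obtains J :: "real ^ 'n \<Rightarrow> int"
    where "\<And>x y. y \<in> dyadic_cube (J x) x \<Longrightarrow> J y = J x"
      and "\<And>x. ennreal (2 powi J x) \<le> \<rho> x"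
      and "\<And>x. \<rho> x \<le> ennreal (2 * C * real CARD('n) * 2 powi J x)"
proof -
  define small where "small j x \<longleftrightarrow> (\<forall>y\<in>dyadic_cube j x. ennreal (2 powi j) \<le> \<rho> y)" for j x
  define b where "b = C * real CARD('n)"
  have "0 < b" using \<open>0 < C\<close> by (simp add: b_def)
  have not_small: "\<rho> x \<le> ennreal (b * 2 powi j)" if large: "\<not> small j x" for j x
  proof -
    obtain y where y: "y \<in> dyadic_cube j x" "\<rho> y < ennreal (2 powi j)"
      using large by (auto simp: small_def not_le)
    have "ennreal (2 powi j) \<le> ennreal (real CARD('n) * 2 powi j)"
      by (intro ennreal_leI) simp
    then have "\<rho> x \<le> ennreal (C * (real CARD('n) * 2 powi j))"
      using y dist_dyadic_cube[OF y(1)] by (intro comp[of _ x y]) (auto intro: order_less_le_trans)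
    then show ?thesis by (simp add: b_def mult.assoc)
  qed
  have maximal: "\<exists>j. small j x \<and> (\<forall>k>j. \<not> small k x)" for x
  proof -
    obtain r where r: "\<rho> x = ennreal r" "0 < r"
      using pos[of x] fin[of x] by (cases "\<rho> x") auto
    obtain m where m: "(1 / 2) ^ m < r / b"
      using real_arch_pow_inv[of "r / b" "1 / 2"] r \<open>0 < b\<close> by auto
    have "small (- int m) x"
    proof (rule ccontr)
      assume "\<not> small (- int m) x"
      from not_small[OF this] have "r \<le> b * 2 powi (- int m)"
        using r \<open>0 < b\<close> by simp
      also have "\<dots> = b * (1 / 2) ^ m"
        by (simp add: power_int_minus power_one_over divide_simps)
      also have "\<dots> < r"
        using m \<open>0 < b\<close> by (simp add: pos_less_divide_eq mult.commute)
      finally show False by simp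
    qed
    moreover obtain M where M: "r < 2 ^ M"
      using real_arch_pow[of 2 r] by auto
    have bound: "j \<le> int M" if "small j x" for j
    proof (rule ccontr)
      assume "\<not> j \<le> int M"
      then have "(2::real) powi int M \<le> 2 powi j"
        by (intro power_int_increasing) auto
      moreover have "ennreal (2 powi j) \<le> \<rho> x"
        using that dyadic_cube_self by (auto simp: small_def)
      ultimately show False using M r by simp
    qed
    define S where "S = {j. small j x \<and> - int m \<le> j}"
    have "finite S"
      using bound by (intro finite_subset[of S "{- int m..int M}"]) (auto simp: S_def)
    have "S \<noteq> {}" using \<open>small (- int m) x\<close> by (auto simp: S_def)
    have "Max S \<in> S" using \<open>finite S\<close> \<open>S \<noteq> {}\<close> by (rule Max_in)
    moreover have "\<not> small k x" if "k > Max S" for k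
    proof
      assume "small k x"
      then have "k \<in> S" using that \<open>Max S \<in> S\<close> by (auto simp: S_def)
      then show False using Max_ge[OF \<open>finite S\<close>] that by (meson not_le)
    qed
    moreover have "small j x" if "j \<in> S" for j
      using that by (simp add: S_def)
    ultimately show ?thesis by blast
  qed
  define J where "J x = (SOME j. small j x \<and> (\<forall>k>j. \<not> small k x))" for x
  have "small (J x) x \<and> (\<forall>k>J x. \<not> small k x)" for x
    unfolding J_def by (rule someI_ex[OF maximal])
  then have J: "small (J x) x" and max: "J x < k \<Longrightarrow> \<not> small k x" for x k
    by simp_all
  have small_cong: "small j y = small j x" if "y \<in> dyadic_cube j x" for j x y
    using dyadic_cube_eq[OF that] by (simp add: small_def)
  show thesis
  proof (rule that[of J])
    fix x y assume y: "y \<in> dyadic_cube (J x) x"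
    then have "J x \<le> J y"
      using J[of x] max[of y "J x"] small_cong[OF y] by (meson not_le)
    then have "y \<in> dyadic_cube (J y) x"
      using y dyadic_cube_mono by blast
    then have "J y \<le> J x"
      using J[of y] max[of x "J y"] small_cong by (meson not_le)
    with \<open>J x \<le> J y\<close> show "J y = J x" by simp
  next
    fix x show "ennreal (2 powi J x) \<le> \<rho> x"
      using J[of x] dyadic_cube_self by (auto simp: small_def)
  next
    fix x
    have "\<rho> x \<le> ennreal (b * 2 powi (J x + 1))"
      by (intro not_small max) simp
    then show "\<rho> x \<le> ennreal (2 * C * real CARD('n) * 2 powi J x)"
      by (simp add: b_def power_int_add mult_ac)
  qed
qed

theorem theorem1p2:
  fixes V :: "real ^ 'n \<Rightarrow> real" and r0 :: real
  assumes "CARD('n) \<ge> 3"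
    and "V \<in> reverse_Hoelder (real CARD('n) / 2)"
    and "r0 > 0"
    and "assumption_A1 r0 V"
    and "assumption_A2 r0 V"
    and "assumption_A3 r0 V"
  shows "\<exists>(\<D> :: (real ^ 'n) set set) (D :: nat \<Rightarrow> (real ^ 'n) set set).
    \<D> = (\<Union>k. D k) \<and>
    (\<forall>Q\<in>\<D>. is_cube Q) \<and>
    (\<forall>k. partition_on UNIV (D k) \<and>
         pairwise (\<lambda>P Q. interior P \<inter> interior Q = {}) (D k)) \<and>
    (\<forall>k l. k > l \<longrightarrow> (\<forall>Q\<in>D l. \<forall>P\<in>D k. Q \<inter> P = {} \<or> Q \<inter> P = P)) \<and>
    (\<exists>C>0. \<forall>k. \<forall>Q\<in>D k. \<forall>x\<in>Q.
         ennreal (side_length Q) \<le> ennreal C * (ennreal (1 / 2 ^ k) * critical_radius x V) \<and>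
         ennreal (1 / 2 ^ k) * critical_radius x V \<le> ennreal C * ennreal (side_length Q))"
proof -
  interpret reverse_Hoelder_potential V
    using assms by unfold_locales
  have "\<exists>z. 0 < mass (ball z r0)"
  proof -
    obtain z :: "real ^ 'n" where z: "norm z = r0"
      using vector_choose_size[of r0] \<open>r0 > 0\<close> by auto
    obtain c where "0 < c" "c \<le> (1 / norm z ^ (CARD('n) - 2)) * mass (ball z (norm z))"
      using assms(4) z by (auto simp: assumption_A1_def mass_def)
    then have "0 < (1 / r0 ^ (CARD('n) - 2)) * mass (ball z r0)"
      using z by simp
    then show ?thesis
      using \<open>r0 > 0\<close> by (auto simp: zero_less_mult_iff zero_less_divide_iff)
  qed
  then have fin: "critical_radius x V < \<infinity>" for x
    using critical_radius_finite by blast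
  obtain C where "0 < C" and comp: "\<And>x y d. 0 < d \<Longrightarrow> dist x y \<le> d \<Longrightarrow>
      critical_radius y V < ennreal d \<Longrightarrow> critical_radius x V \<le> ennreal (C * d)"
    using critical_radius_comparison by metis
  obtain J :: "real ^ 'n \<Rightarrow> int"
    where J: "\<And>x y. y \<in> dyadic_cube (J x) x \<Longrightarrow> J y = J x"
      and lower: "\<And>x. ennreal (2 powi J x) \<le> critical_radius x V"
      and upper: "\<And>x. critical_radius x V \<le> ennreal (2 * C * real CARD('n) * 2 powi J x)"
    using exists_adapted_dyadic_cubes[of "\<lambda>x. critical_radius x V" C,
        OF critical_radius_pos fin \<open>0 < C\<close>] comp by blast
  \<comment> \<open>Generation \<open>k\<close> lies \<open>k\<close> dyadic levels below the stopping cube, so its cube around \<open>x\<close> is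
    determined by \<open>x\<close>, and \<open>J\<close> is constant on it.\<close>
  define E where "E k x = dyadic_cube (J x - int k) x" for k x
  define D where "D k = range (E k)" for k
  have self: "x \<in> E k x" for k x
    by (simp add: E_def dyadic_cube_self)
  have anti: "E k x \<subseteq> E l x" if "l \<le> k" for k l x
    using that by (simp add: E_def dyadic_cube_mono)
  have J_eq: "J y = J x" if "y \<in> E k x" for k x y
    using that anti[of 0 k x] J by (auto simp: E_def)
  have E_eq: "E k y = E k x" if "y \<in> E k x" for k x y
    using that J_eq[OF that] dyadic_cube_eq by (simp add: E_def)
  have D_eq: "Q = E k x" if "Q \<in> D k" "x \<in> Q" for Q k x
    using that E_eq by (auto simp: D_def)
  have disj: "disjoint (D k)" for k
    unfolding disjoint_def using D_eq by blast
  have part: "partition_on UNIV (D k)" for k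
    unfolding partition_on_def using disj[of k] self by (auto simp: D_def)
  have int: "pairwise (\<lambda>P Q. interior P \<inter> interior Q = {}) (D k)" for k
  proof (rule pairwiseI)
    fix P Q assume "P \<in> D k" "Q \<in> D k" "P \<noteq> Q"
    then have "P \<inter> Q = {}" using disj[of k] by (auto simp: disjoint_def)
    then show "interior P \<inter> interior Q = {}"
      using interior_subset[of P] interior_subset[of Q] by blast
  qed
  have cubes: "is_cube Q" if "Q \<in> D k" for Q k
    using that is_cube_dyadic_cube by (auto simp: D_def E_def)
  have nested: "Q \<inter> P = {} \<or> Q \<inter> P = P" if "l < k" "Q \<in> D l" "P \<in> D k" for k l Q P
  proof (cases "Q \<inter> P = {}")
    case False
    then obtain x where "x \<in> Q" "x \<in> P" by blast
    then have "Q = E l x" "P = E k x" using that D_eq by blast+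
    then show ?thesis using anti[of l k x] that by auto
  qed simp
  define B where "B = max 1 (2 * C * real CARD('n))"
  have size: "ennreal (side_length Q) \<le> ennreal B * (ennreal (1 / 2 ^ k) * critical_radius x V) \<and>
      ennreal (1 / 2 ^ k) * critical_radius x V \<le> ennreal B * ennreal (side_length Q)"
    if "Q \<in> D k" "x \<in> Q" for k Q x
  proof -
    have "side_length Q = 2 powi (J x - int k)"
      using D_eq[OF that] by (simp add: E_def side_length_dyadic_cube)
    then have side: "side_length Q = 1 / 2 ^ k * 2 powi J x"
      by (simp add: power_int_diff)
    have "ennreal (side_length Q) = ennreal (1 / 2 ^ k) * ennreal (2 powi J x)"
      unfolding side by (rule ennreal_mult) auto
    also have "\<dots> \<le> ennreal (1 / 2 ^ k) * critical_radius x V"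
      by (intro mult_left_mono lower) simp
    also have "\<dots> \<le> ennreal B * (ennreal (1 / 2 ^ k) * critical_radius x V)"
      using mult_right_mono[of 1 "ennreal B"] by (simp add: B_def)
    finally have 1: "ennreal (side_length Q) \<le> \<dots>" .
    have "2 * C * real CARD('n) * 2 powi J x \<le> B * 2 powi J x"
      by (intro mult_right_mono) (auto simp: B_def)
    then have "critical_radius x V \<le> ennreal (B * 2 powi J x)"
      using upper[of x] by (meson ennreal_leI order_trans)
    then have "ennreal (1 / 2 ^ k) * critical_radius x V \<le> ennreal (1 / 2 ^ k) * ennreal (B * 2 powi J x)"
      by (rule mult_left_mono) simp
    also have "\<dots> = ennreal B * ennreal (side_length Q)"
      unfolding side by (simp add: B_def mult_ac flip: ennreal_mult)
    finally show ?thesis using 1 by simp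
  qed
  have "0 < B" by (simp add: B_def)
  show ?thesis
    by (intro exI[of _ "\<Union>k. D k"] exI[of _ D] exI[of _ B] conjI allI impI ballI refl part int
        \<open>0 < B\<close> nested) (use cubes size in auto)
qed

end
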